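(* Let $0<k<1$ and $q=4k/(k+1)^2$. If $f$ is a complex-valued $k$-quasiregular harmonic function defined on a region $G\subset\mathbb C$, then $|f|^q$ is subharmonic on $G$. The exponent $q$ is optimal: for every $p$ with $0<p<q$ there exist a region and a complex-valued $k$-quasiregular harmonic function $f$ on it such that $|f|^p$ is not subharmonic.
   Context: A complex-valued harmonic function $f$ on a region $G\subset\mathbb C$ is $k$-quasiregular ($0<k<1$) if $|\bar\partial f(z)|\le k|\partial f(z)|$ for all $z\in G$, where $\bar\partial f=\frac12(\partial_xf+i\partial_yf)$ and $\partial f=\frac12(\partial_xf-i\partial_yf)$, $z=x+iy$. A continuous function $u$ on $G$ is subharmonic if for every $z_0\in G$ there is $\varepsilon>0$ with $u(z_0)\le\frac1{2\pi}\int_0^{2\pi}u(z_0+re^{it})\,dt$ for $0<r<\varepsilon$. *)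

theory Defs
  imports "HOL-Analysis.Analysis"
begin

definition region :: "complex set \<Rightarrow> bool" where
  "region G \<longleftrightarrow> open G \<and> connected G \<and> G \<noteq> {}"

definition partial_x :: "(complex \<Rightarrow> complex) \<Rightarrow> complex \<Rightarrow> complex" where
  "partial_x f z = vector_derivative (\<lambda>t::real. f (z + of_real t)) (at 0)"

definition partial_y :: "(complex \<Rightarrow> complex) \<Rightarrow> complex \<Rightarrow> complex" where
  "partial_y f z = vector_derivative (\<lambda>t::real. f (z + \<i> * of_real t)) (at 0)"

definition wirtinger :: "(complex \<Rightarrow> complex) \<Rightarrow> complex \<Rightarrow> complex" where
  "wirtinger f z = (partial_x f z - \<i> * partial_y f z) / 2"

definition wirtinger_bar :: "(complex \<Rightarrow> complex) \<Rightarrow> complex \<Rightarrow> complex" where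
  "wirtinger_bar f z = (partial_x f z + \<i> * partial_y f z) / 2"

text \<open>The predicate \<open>differentiable\<close> below is real (Frechet) differentiability;
  \<open>C1_on\<close>, \<open>C2_on\<close> and \<open>harmonic_on\<close> are meant for open sets.\<close>

definition C1_on :: "complex set \<Rightarrow> (complex \<Rightarrow> complex) \<Rightarrow> bool" where
  "C1_on G f \<longleftrightarrow> (\<forall>z\<in>G. f differentiable (at z)) \<and>
     continuous_on G (partial_x f) \<and> continuous_on G (partial_y f)"

definition C2_on :: "complex set \<Rightarrow> (complex \<Rightarrow> complex) \<Rightarrow> bool" where
  "C2_on G f \<longleftrightarrow> C1_on G f \<and> C1_on G (partial_x f) \<and> C1_on G (partial_y f)"

definition harmonic_on :: "complex set \<Rightarrow> (complex \<Rightarrow> complex) \<Rightarrow> bool" where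
  "harmonic_on G f \<longleftrightarrow> C2_on G f \<and>
     (\<forall>z\<in>G. partial_x (partial_x f) z + partial_y (partial_y f) z = 0)"

definition quasiregular_harmonic_on :: "real \<Rightarrow> complex set \<Rightarrow> (complex \<Rightarrow> complex) \<Rightarrow> bool" where
  "quasiregular_harmonic_on k G f \<longleftrightarrow> harmonic_on G f \<and>
     (\<forall>z\<in>G. cmod (wirtinger_bar f z) \<le> k * cmod (wirtinger f z))"

text \<open>The condition \<open>ball z0 \<epsilon> \<subseteq> G\<close> keeps the circles of integration inside \<open>G\<close>,
  where \<open>u\<close> is meaningful; for open \<open>G\<close> it only asks for \<open>\<epsilon>\<close> to be small.\<close>

definition subharmonic_on :: "complex set \<Rightarrow> (complex \<Rightarrow> real) \<Rightarrow> bool" where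
  "subharmonic_on G u \<longleftrightarrow> continuous_on G u \<and>
     (\<forall>z0\<in>G. \<exists>\<epsilon>>0. ball z0 \<epsilon> \<subseteq> G \<and>
        (\<forall>r. 0 < r \<and> r < \<epsilon> \<longrightarrow>
           u z0 \<le> 1 / (2 * pi) *
             integral {0..2 * pi} (\<lambda>t. u (z0 + of_real r * exp (\<i> * of_real t)))))"

end

theory Submission
  imports Defs
begin

text \<open>Where \<open>f \<noteq> 0\<close>, in log-polar coordinates \<open>z = z0 + exp (s + \<i>t)\<close> the function \<open>F(s, t) = f z\<close> is
  again harmonic and \<open>k\<close>-quasiregular, and nonnegativity of the Laplacian of \<open>|F|\<^sup>q\<close> reduces to the
  inequality \<open>(1 - q/2) (P + M)\<^sup>2 \<le> P\<^sup>2 + M\<^sup>2\<close> for the moduli \<open>M \<le> k P\<close> of the two Wirtinger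
  derivatives of \<open>F\<close>.
  Integrating over \<open>t\<close> kills the \<open>t\<close>-derivatives, so the circle mean is a convex function of \<open>s\<close>; it
  is bounded as \<open>s\<close> tends to \<open>-\<infinity>\<close>, hence increasing, and its limit is the value at the centre.
  At zeros of \<open>f\<close> there is nothing to prove.
  For optimality, \<open>f z = z + k * cnj z\<close> attains equality in the pointwise inequality at \<open>z = 1\<close>.\<close>

section \<open>Powers of a norm along a curve, and the pointwise inequality\<close>

lemma norm_powr_has_real_derivative:
  fixes F :: "real \<Rightarrow> 'a::real_inner"
  assumes F: "(F has_vector_derivative F') (at s)" and nz: "F s \<noteq> 0"
  shows "((\<lambda>s. norm (F s) powr q) has_real_derivative
           q * norm (F s) powr (q - 2) * (F s \<bullet> F')) (at s)"
proof -
  have "((\<lambda>s. norm (F s)) has_derivative (\<lambda>h. (h *\<^sub>R F') \<bullet> sgn (F s))) (at s)"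
    using has_derivative_compose[OF F[unfolded has_vector_derivative_def] has_derivative_norm[OF nz]]
    by simp
  then have "((\<lambda>s. norm (F s)) has_real_derivative (F s \<bullet> F') / norm (F s)) (at s)"
    unfolding has_field_derivative_def
    by (rule has_derivative_eq_rhs) (auto simp: sgn_div_norm inner_commute divide_inverse mult_ac)
  from DERIV_chain2[OF has_real_derivative_powr this, of q] nz
  have "((\<lambda>s. norm (F s) powr q) has_real_derivative
      q * norm (F s) powr (q - 1) * ((F s \<bullet> F') / norm (F s))) (at s)"
    by (simp add: mult_ac)
  moreover have "norm (F s) powr (q - 1) = norm (F s) powr (q - 2) * norm (F s)"
    using nz powr_add[of "norm (F s)" "q - 2" 1] by simp
  ultimately show ?thesis using nz by (simp add: mult_ac)
qed

text \<open>Product rule, with the previous lemma applied to the exponent \<open>q - 2\<close>. The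
  factor \<open>norm (F s) powr (q - 4)\<close> is pulled out so that, when two directions are
  added, only the sign of the bracket matters.\<close>

lemma norm_powr_has_second_derivative:
  fixes F G :: "real \<Rightarrow> 'a::real_inner"
  assumes F: "(F has_vector_derivative G s) (at s)" and G: "(G has_vector_derivative H) (at s)"
    and nz: "F s \<noteq> 0"
  shows "((\<lambda>s. q * norm (F s) powr (q - 2) * (F s \<bullet> G s)) has_real_derivative
           q * norm (F s) powr (q - 4) *
             ((q - 2) * (F s \<bullet> G s)\<^sup>2 + (norm (F s))\<^sup>2 * (G s \<bullet> G s + F s \<bullet> H))) (at s)"
proof -
  have "((\<lambda>s. F s \<bullet> G s) has_real_derivative (F s \<bullet> H + G s \<bullet> G s)) (at s)"
    using bounded_bilinear.has_vector_derivative[OF bounded_bilinear_inner F G]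
    by (simp add: has_real_derivative_iff_has_vector_derivative)
  note D = DERIV_mult[OF DERIV_cmult[OF norm_powr_has_real_derivative[OF F nz, of "q - 2"], of q] this]
  have "norm (F s) powr (q - 2) = norm (F s) powr (q - 4) * (norm (F s))\<^sup>2"
    using nz powr_add[of "norm (F s)" "q - 4" 2] by simp
  with D show ?thesis
    by (elim DERIV_cong) (simp add: power2_eq_square algebra_simps)
qed

text \<open>If \<open>A\<close> and \<open>B\<close> are the derivatives of a map along orthonormal
  directions, \<open>P\<close> and \<open>M\<close> are twice the moduli of its Wirtinger
  derivatives. The projections on \<open>e\<close> together have size at most
  \<open>cmod e * (P + M) / 2\<close>, whereas the full energy is
  \<open>(P\<^sup>2 + M\<^sup>2) / 2\<close>. Under \<open>M \<le> k * P\<close> the quotient of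
  \<open>(P + M)\<^sup>2\<close> by \<open>P\<^sup>2 + M\<^sup>2\<close> peaks at
  \<open>M = k * P\<close>, with value \<open>2 / (2 - q)\<close>.\<close>

lemma quasiconformal_inequality:
  fixes A B e :: complex
  assumes k: "0 < k" "k < 1" and q: "q = 4 * k / (k + 1)\<^sup>2"
    and AB: "cmod (A + \<i> * B) \<le> k * cmod (A - \<i> * B)"
  shows "(2 - q) * ((e \<bullet> A)\<^sup>2 + (e \<bullet> B)\<^sup>2) \<le> (cmod e)\<^sup>2 * (A \<bullet> A + B \<bullet> B)"
proof -
  define P where "P = cmod (A - \<i> * B)"
  define M where "M = cmod (A + \<i> * B)"
  have PM: "0 \<le> M" "M \<le> k * P" "0 \<le> P" using AB by (auto simp: P_def M_def)
  have q1: "2 - q = 2 * (1 + k\<^sup>2) / (k + 1)\<^sup>2"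
    using k by (simp add: q field_simps) (simp add: power2_eq_square algebra_simps)
  have "2 * Complex (e \<bullet> A) (- (e \<bullet> B)) = cnj e * (A - \<i> * B) + e * cnj (A + \<i> * B)"
    by (simp add: complex_eq_iff inner_complex_def algebra_simps)
  then have "2 * cmod (Complex (e \<bullet> A) (- (e \<bullet> B))) \<le> cmod e * P + cmod e * M"
    unfolding P_def M_def
    by (metis complex_mod_cnj norm_mult norm_triangle_ineq norm_numeral)
  then have "(2 * cmod (Complex (e \<bullet> A) (- (e \<bullet> B))))\<^sup>2 \<le> (cmod e * (P + M))\<^sup>2"
    by (intro power_mono) (auto simp: algebra_simps)
  then have 1: "4 * ((e \<bullet> A)\<^sup>2 + (e \<bullet> B)\<^sup>2) \<le> (cmod e)\<^sup>2 * (P + M)\<^sup>2"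
    by (simp add: power_mult_distrib cmod_power2)
  have 2: "2 * (A \<bullet> A + B \<bullet> B) = P\<^sup>2 + M\<^sup>2"
    unfolding P_def M_def cmod_power2 by (simp add: inner_complex_def power2_eq_square algebra_simps)
  \<comment> \<open>Twice this product is exactly \<open>(P\<^sup>2 + M\<^sup>2) * (k + 1)\<^sup>2 -
    (1 + k\<^sup>2) * (P + M)\<^sup>2\<close>.\<close>
  have "0 \<le> (k * P - M) * (P - k * M)"
  proof (rule mult_nonneg_nonneg)
    have "k * M \<le> k * (k * P)" using PM k by (intro mult_left_mono) auto
    also have "\<dots> \<le> 1 * P" unfolding mult.assoc[symmetric] using k PM
      by (intro mult_right_mono) (auto simp: mult_le_one)
    finally show "0 \<le> P - k * M" by simp
  qed (use PM in auto)
  then have "(1 + k\<^sup>2) * (P + M)\<^sup>2 \<le> (P\<^sup>2 + M\<^sup>2) * (k + 1)\<^sup>2"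
    by (simp add: power2_eq_square algebra_simps)
  then have "(2 - q) * (P + M)\<^sup>2 \<le> 2 * (P\<^sup>2 + M\<^sup>2)"
    using k unfolding q1 by (simp add: divide_le_eq) (simp add: algebra_simps)
  with 2 have 3: "(2 - q) * (P + M)\<^sup>2 \<le> 4 * (A \<bullet> A + B \<bullet> B)" by simp
  have "0 \<le> 2 - q" unfolding q1 by simp
  from mult_left_mono[OF 1 this] mult_left_mono[OF 3, of "(cmod e)\<^sup>2"]
  show ?thesis by (simp add: algebra_simps)
qed

section \<open>Two real-variable tools: means along log-polar lines, and a quadratic bound for
  powers\<close>

text \<open>A convex function bounded above on a half-line reaching to \<open>-\<infinity>\<close>
  cannot have a negative slope. Convexity comes from \<open>laplacian\<close>, since
  \<open>Vtt\<close> integrates to zero over a period; the fundamental theorem of calculus gives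
  this without continuity of \<open>Vtt\<close>.\<close>

lemma log_polar_integral_mono:
  fixes V Vs Vss Vt Vtt :: "real \<Rightarrow> real \<Rightarrow> real"
  assumes Vs: "\<And>s t. s < S \<Longrightarrow> ((\<lambda>s. V s t) has_real_derivative Vs s t) (at s)"
    and Vss: "\<And>s t. s < S \<Longrightarrow> ((\<lambda>s. Vs s t) has_real_derivative Vss s t) (at s)"
    and Vtt: "\<And>s t. s < S \<Longrightarrow> ((\<lambda>t. Vt s t) has_real_derivative Vtt s t) (at t)"
    and periodic: "\<And>s. s < S \<Longrightarrow> Vt s (2 * pi) = Vt s 0"
    and cont: "continuous_on ({..<S} \<times> UNIV) (\<lambda>(s, t). V s t)"
      "continuous_on ({..<S} \<times> UNIV) (\<lambda>(s, t). Vs s t)"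
      "continuous_on ({..<S} \<times> UNIV) (\<lambda>(s, t). Vss s t)"
    and laplacian: "\<And>s t. s < S \<Longrightarrow> 0 \<le> Vss s t + Vtt s t"
    and bounded: "\<And>s t. s < S \<Longrightarrow> V s t \<le> B"
    and s: "s1 \<le> s2" "s2 < S"
  shows "integral {0..2 * pi} (V s1) \<le> integral {0..2 * pi} (V s2)"
proof -
  define M where "M s = integral {0..2 * pi} (V s)" for s
  define M1 where "M1 s = integral {0..2 * pi} (Vs s)" for s
  define M2 where "M2 s = integral {0..2 * pi} (Vss s)" for s
  have int: "(\<lambda>t. W s t) integrable_on {0..2 * pi}"
    if "continuous_on ({..<S} \<times> UNIV) (\<lambda>(s, t). W s t)" "s < S" for W :: "real \<Rightarrow> real \<Rightarrow> real" and s
    by (rule integrable_continuous_interval, rule continuous_on_compose2[OF that(1), of _ "Pair s", simplified])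
       (use that(2) in \<open>auto intro!: continuous_intros\<close>)
  have D: "((\<lambda>s. integral {0..2 * pi} (W s)) has_real_derivative integral {0..2 * pi} (W1 s)) (at s)"
    if "continuous_on ({..<S} \<times> UNIV) (\<lambda>(s, t). W s t)" "continuous_on ({..<S} \<times> UNIV) (\<lambda>(s, t). W1 s t)"
      "\<And>s t. s < S \<Longrightarrow> ((\<lambda>s. W s t) has_real_derivative W1 s t) (at s)" "s < S"
    for W W1 :: "real \<Rightarrow> real \<Rightarrow> real" and s
  proof -
    have "((\<lambda>s. integral (cbox 0 (2 * pi)) (W s)) has_real_derivative integral (cbox 0 (2 * pi)) (W1 s)) (at s within {..<S})"
    proof (rule leibniz_rule_field_derivative)
      show "continuous_on ({..<S} \<times> cbox 0 (2 * pi)) (\<lambda>(x, t). W1 x t)"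
        by (rule continuous_on_subset[OF that(2)]) auto
    qed (use that int[OF that(1)] in \<open>auto intro: has_field_derivative_at_within\<close>)
    then show ?thesis using at_within_open[of s "{..<S}"] that(4) by simp
  qed
  have M: "(M has_real_derivative M1 s) (at s)" if "s < S" for s
    unfolding M_def M1_def by (rule D[OF cont(1,2) Vs that])
  have M1: "(M1 has_real_derivative M2 s) (at s)" if "s < S" for s
    unfolding M1_def M2_def by (rule D[OF cont(2,3) Vss that])
  have M2: "0 \<le> M2 s" if "s < S" for s
  proof -
    have "(Vtt s has_integral Vt s (2 * pi) - Vt s 0) {0..2 * pi}"
      by (rule fundamental_theorem_of_calculus)
        (use Vtt[OF that] in \<open>auto simp: has_real_derivative_iff_has_vector_derivative
          intro: has_vector_derivative_at_within\<close>)
    then have "((\<lambda>t. Vss s t + Vtt s t) has_integral M2 s + 0) {0..2 * pi}"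
      unfolding M2_def using periodic[OF that] int[OF cont(3) that]
      by (intro has_integral_add) auto
    then show ?thesis using laplacian[OF that] by (simp add: has_integral_nonneg)
  qed
  have M1_mono: "M1 s \<le> M1 s'" if "s \<le> s'" "s' < S" for s s'
  proof (rule DERIV_nonneg_imp_nondecreasing[OF that(1)])
    fix x assume "x \<le> s'"
    with that have "x < S" by simp
    then show "\<exists>y. (M1 has_real_derivative y) (at x) \<and> 0 \<le> y"
      using M1[of x] M2[of x] by blast
  qed
  have M1_nonneg: "0 \<le> M1 s0" if "s0 < S" for s0
  proof (rule ccontr)
    assume neg: "\<not> 0 \<le> M1 s0"
    \<comment> \<open>Following a line of slope \<open>M1 s0\<close> from \<open>s0\<close>
      leftwards to this point raises it by \<open>1 + \<bar>2 * pi * B - M s0\<bar>\<close>, hence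
      above \<open>2 * pi * B\<close>. By monotonicity of \<open>M1\<close>, the function
      \<open>M\<close> rises at least as much.\<close>
    define s where "s = s0 - (1 + \<bar>2 * pi * B - M s0\<bar>) / (- M1 s0)"
    have less: "s < s0" using neg by (simp add: s_def divide_pos_neg)
    have "\<exists>x>s. x < s0 \<and> M s0 - M s = (s0 - s) * M1 x"
      by (rule MVT2[OF less], rule M) (use that in auto)
    then obtain x where x: "s < x" "x < s0" "M s0 - M s = (s0 - s) * M1 x" by blast
    have "(s0 - s) * M1 x \<le> (s0 - s) * M1 s0"
      using x less that by (intro mult_left_mono M1_mono) auto
    also have "\<dots> = - (1 + \<bar>2 * pi * B - M s0\<bar>)" using neg by (simp add: s_def field_simps)
    finally have "2 * pi * B < M s" using x by linarith
    moreover have "M s \<le> integral {0..2 * pi} (\<lambda>_. B)" unfolding M_def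
      by (rule integral_le[OF int[OF cont(1)]]) (use less that bounded in auto)
    ultimately show False by simp
  qed
  have "M s1 \<le> M s2"
  proof (rule DERIV_nonneg_imp_nondecreasing[OF s(1)])
    fix x assume "x \<le> s2"
    with s have "x < S" by simp
    then show "\<exists>y. (M has_real_derivative y) (at x) \<and> 0 \<le> y"
      using M[of x] M1_nonneg[of x] by blast
  qed
  then show ?thesis by (simp only: M_def)
qed

text \<open>The difference \<open>g\<close> of the two sides has \<open>g 0 = 0\<close>,
  \<open>g' 0 = 0\<close> and second derivative \<open>- 2 * \<eta>\<close> at 0. So
  \<open>g'\<close> passes from positive to negative there, and 0 is a local maximum of
  \<open>g\<close>.\<close>

lemma powr_le_quadratic:
  fixes a :: real
  assumes "0 < \<eta>"
  shows "\<exists>\<delta>>0. \<forall>x. \<bar>x\<bar> < \<delta> \<longrightarrow> (1 + x) powr a \<le> 1 + a * x + (a * (a - 1) / 2 + \<eta>) * x\<^sup>2"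
proof -
  define b where "b = a * (a - 1) / 2 + \<eta>"
  define g where "g x = (1 + x) powr a - (1 + a * x + b * x\<^sup>2)" for x
  define g' where "g' x = a * (1 + x) powr (a - 1) - (a + 2 * b * x)" for x
  have g: "(g has_real_derivative g' x) (at x)" if "\<bar>x\<bar> < 1" for x
    unfolding g_def g'_def using that
    by (auto intro!: derivative_eq_intros simp: powr_diff field_simps)
  have "(g' has_real_derivative a * (a - 1) - 2 * b) (at 0)"
    unfolding g'_def by (auto intro!: derivative_eq_intros)
  moreover have "a * (a - 1) - 2 * b < 0" using assms by (simp add: b_def)
  ultimately have "\<exists>d>0. \<forall>h>0. h < d \<longrightarrow> g' h < 0" "\<exists>d>0. \<forall>h>0. h < d \<longrightarrow> 0 < g' (- h)"
    using DERIV_neg_dec_right[of g' _ 0] DERIV_neg_dec_left[of g' _ 0] by (auto simp: g'_def)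
  then obtain d1 d2 where d: "0 < d1" "\<And>h. 0 < h \<Longrightarrow> h < d1 \<Longrightarrow> g' h < 0"
    "0 < d2" "\<And>h. 0 < h \<Longrightarrow> h < d2 \<Longrightarrow> 0 < g' (- h)" by blast
  define \<delta> where "\<delta> = min 1 (min d1 d2)"
  have "g x \<le> g 0" if "\<bar>x\<bar> < \<delta>" for x
  proof (cases "0 \<le> x")
    case True
    have "\<exists>y. (g has_real_derivative y) (at z) \<and> y \<le> 0" if "0 \<le> z" "z \<le> x" for z
      using g[of z] d(2)[of z] that \<open>\<bar>x\<bar> < \<delta>\<close> by (cases "z = 0") (force simp: \<delta>_def g'_def)+
    then show ?thesis using DERIV_nonpos_imp_nonincreasing[OF True] by blast
  next
    case False
    have "\<exists>y. (g has_real_derivative y) (at z) \<and> 0 \<le> y" if "x \<le> z" "z \<le> 0" for z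
      using g[of z] d(4)[of "- z"] that \<open>\<bar>x\<bar> < \<delta>\<close> by (cases "z = 0") (force simp: \<delta>_def g'_def)+
    then show ?thesis using DERIV_nonneg_imp_nondecreasing[of x 0 g] False by force
  qed
  moreover have "0 < \<delta>" using d by (simp add: \<delta>_def)
  ultimately show ?thesis unfolding g_def b_def by (intro exI[of _ \<delta>]) simp
qed

section \<open>Chain rules for the partial derivatives, and rotated frames\<close>

text \<open>The partials are choice values of \<open>vector_derivative\<close>. Differentiability
  identifies them with the values of the Frechet derivative at 1 and \<open>\<i>\<close>, which
  determine it by real linearity.\<close>

lemma C1_on_has_derivative:
  assumes "C1_on G f" "z \<in> G"
  shows "(f has_derivative (\<lambda>h. Re h *\<^sub>R partial_x f z + Im h *\<^sub>R partial_y f z)) (at z)"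
proof -
  from assms obtain D where D: "(f has_derivative D) (at z)"
    by (auto simp: C1_on_def differentiable_def)
  interpret bounded_linear D by (rule has_derivative_bounded_linear[OF D])
  have D0: "(f has_derivative D) (at (z + c * of_real 0))" for c using D by simp
  have line: "((\<lambda>t::real. f (z + c * of_real t)) has_vector_derivative D c) (at 0)" for c
  proof -
    have "((\<lambda>t::real. z + c * of_real t) has_derivative (\<lambda>t. c * of_real t)) (at 0)"
      by (auto intro!: derivative_eq_intros)
    from has_derivative_compose[OF this D0[of c]] show ?thesis
      unfolding has_vector_derivative_def
      by (rule has_derivative_eq_rhs)
        (use scaleR[of _ c] in \<open>simp add: fun_eq_iff scaleR_conv_of_real mult.commute\<close>)
  qed
  have partials: "partial_x f z = D 1" "partial_y f z = D \<i>"
    using vector_derivative_at[OF line[of 1]] vector_derivative_at[OF line[of \<i>]]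
    by (simp_all add: partial_x_def partial_y_def)
  have D_eq: "D h = Re h *\<^sub>R D 1 + Im h *\<^sub>R D \<i>" for h
  proof -
    have "Re h *\<^sub>R 1 + Im h *\<^sub>R \<i> = h" by (simp add: complex_eq_iff)
    then show ?thesis using add[of "Re h *\<^sub>R 1" "Im h *\<^sub>R \<i>"] scaleR[of "Re h" 1] scaleR[of "Im h" \<i>] by simp
  qed
  have "(f has_derivative (\<lambda>h. Re h *\<^sub>R D 1 + Im h *\<^sub>R D \<i>)) (at z)"
    by (rule has_derivative_eq_rhs[OF D], rule ext, rule D_eq)
  then show ?thesis by (simp only: partials)
qed

text \<open>For \<open>C1_on\<close> functions this is the real differential at \<open>z\<close>
  applied to an unnormalised \<open>v\<close>. Written through the partials, it inherits their
  continuity directly.\<close>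

definition deriv_along :: "(complex \<Rightarrow> complex) \<Rightarrow> complex \<Rightarrow> complex \<Rightarrow> complex" where
  "deriv_along f v z = Re v *\<^sub>R partial_x f z + Im v *\<^sub>R partial_y f z"

lemma C1_on_chain:
  assumes "C1_on G f" "\<gamma> s \<in> G" "(\<gamma> has_vector_derivative v) (at s)"
  shows "((\<lambda>s. f (\<gamma> s)) has_vector_derivative deriv_along f v (\<gamma> s)) (at s)"
  using has_derivative_compose[OF assms(3)[unfolded has_vector_derivative_def]
      C1_on_has_derivative[OF assms(1,2)]]
  unfolding has_vector_derivative_def deriv_along_def
  by (rule has_derivative_eq_rhs) (auto simp: scaleR_add_right)

text \<open>The log-polar velocities are not constant, so the direction \<open>w\<close> moves with
  the curve. The term with \<open>w'\<close> accounts for that motion; the other two form the second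
  differential of \<open>f\<close> in the directions \<open>v\<close> and \<open>w\<close>.\<close>

lemma C2_on_chain:
  assumes "C2_on G f" "\<gamma> s \<in> G" "(\<gamma> has_vector_derivative v) (at s)"
    and w: "(w has_vector_derivative w') (at s)"
  shows "((\<lambda>s. deriv_along f (w s) (\<gamma> s)) has_vector_derivative
    deriv_along f w' (\<gamma> s) + Re (w s) *\<^sub>R deriv_along (partial_x f) v (\<gamma> s) +
      Im (w s) *\<^sub>R deriv_along (partial_y f) v (\<gamma> s)) (at s)"
proof -
  have "((\<lambda>s. Re (w s)) has_real_derivative Re w') (at s)"
       "((\<lambda>s. Im (w s)) has_real_derivative Im w') (at s)"
    using bounded_linear.has_vector_derivative[OF bounded_linear_Re w]
      bounded_linear.has_vector_derivative[OF bounded_linear_Im w]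
    by (simp_all add: has_real_derivative_iff_has_vector_derivative)
  moreover have "C1_on G (partial_x f)" "C1_on G (partial_y f)"
    using assms(1) by (auto simp: C2_on_def)
  note this[THEN C1_on_chain, OF assms(2,3)]
  ultimately show ?thesis
    unfolding deriv_along_def[of f] using w
    by (auto intro!: derivative_eq_intros simp: algebra_simps)
qed


text \<open>Both Wirtinger derivatives are scaled by the same modulus, so the quasiregularity bound
  survives the passage to the frame \<open>v\<close>, \<open>\<i> * v\<close>.\<close>

lemma deriv_along_rotate:
  "deriv_along f v z + \<i> * deriv_along f (\<i> * v) z = 2 * cnj v * wirtinger_bar f z"
  "deriv_along f v z - \<i> * deriv_along f (\<i> * v) z = 2 * v * wirtinger f z"
  by (simp_all add: deriv_along_def wirtinger_def wirtinger_bar_def complex_eq_iff algebra_simps)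

text \<open>The trace of the Hessian in the frame \<open>v\<close>, \<open>\<i> * v\<close> is
  \<open>(cmod v)\<^sup>2\<close> times the Laplacian. Each mixed partial cancels against itself, so
  their symmetry is not invoked.\<close>

lemma second_derivs_along_rotate:
  assumes "partial_x (partial_x f) z + partial_y (partial_y f) z = 0"
  shows "(Re v *\<^sub>R deriv_along (partial_x f) v z + Im v *\<^sub>R deriv_along (partial_y f) v z) +
     (Re (\<i> * v) *\<^sub>R deriv_along (partial_x f) (\<i> * v) z +
      Im (\<i> * v) *\<^sub>R deriv_along (partial_y f) (\<i> * v) z) = 0"
proof -
  have "partial_y (partial_y f) z = - partial_x (partial_x f) z"
    using assms by (simp add: add_eq_0_iff)
  then show ?thesis
    by (simp add: deriv_along_def complex_eq_iff algebra_simps)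
qed

section \<open>Monotone circle means and subharmonicity\<close>

text \<open>The punctured disc becomes the half-plane \<open>s < ln R\<close>, and the circle of
  radius \<open>r\<close> the line \<open>s = ln r\<close>. Absence of zeros makes the power twice
  differentiable, and compactness of the closed ball bounds it as \<open>s\<close> tends to
  \<open>-\<infinity>\<close>.\<close>

lemma integral_circle_norm_powr_mono:
  assumes k: "0 < k" "k < 1" and q: "q = 4 * k / (k + 1)\<^sup>2"
    and f: "quasiregular_harmonic_on k G f" and R: "0 < R" "cball z0 R \<subseteq> G"
    and nz: "\<And>z. z \<in> ball z0 R \<Longrightarrow> f z \<noteq> 0" and r: "0 < r1" "r1 \<le> r2" "r2 < R"
  shows "integral {0..2 * pi} (\<lambda>t. cmod (f (z0 + of_real r1 * exp (\<i> * of_real t))) powr q) \<le>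
         integral {0..2 * pi} (\<lambda>t. cmod (f (z0 + of_real r2 * exp (\<i> * of_real t))) powr q)"
proof -
  define E where "E s t = exp (Complex s t)" for s t
  define \<gamma> where "\<gamma> s t = z0 + E s t" for s t
  define F where "F s t = f (\<gamma> s t)" for s t
  define Fs where "Fs s t = deriv_along f (E s t) (\<gamma> s t)" for s t
  define Ft where "Ft s t = deriv_along f (\<i> * E s t) (\<gamma> s t)" for s t
  define Fss where "Fss s t = Fs s t + Re (E s t) *\<^sub>R deriv_along (partial_x f) (E s t) (\<gamma> s t) +
      Im (E s t) *\<^sub>R deriv_along (partial_y f) (E s t) (\<gamma> s t)" for s t
  \<comment> \<open>The \<open>t\<close>-derivative of \<open>\<i> * E s t\<close> is
    \<open>- E s t\<close>, so the first-order term here is opposite to the one in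
    \<open>Fss\<close> and they cancel in the sum.\<close>
  define Ftt where "Ftt s t = - Fs s t + Re (\<i> * E s t) *\<^sub>R deriv_along (partial_x f) (\<i> * E s t) (\<gamma> s t) +
      Im (\<i> * E s t) *\<^sub>R deriv_along (partial_y f) (\<i> * E s t) (\<gamma> s t)" for s t
  \<comment> \<open>\<open>V1\<close> and \<open>V2\<close> are the first and second derivatives of
    the power; taking the derivatives of \<open>F\<close> as arguments lets them serve both
    variables.\<close>
  define V1 where "V1 F' s t = q * cmod (F s t) powr (q - 2) * (F s t \<bullet> F' s t)"
    for F' :: "real \<Rightarrow> real \<Rightarrow> complex" and s t
  define V2 where "V2 F' F'' s t = q * cmod (F s t) powr (q - 4) *
      ((q - 2) * (F s t \<bullet> F' s t)\<^sup>2 + (cmod (F s t))\<^sup>2 * (F' s t \<bullet> F' s t + F s t \<bullet> F'' s t))"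
    for F' F'' :: "real \<Rightarrow> real \<Rightarrow> complex" and s t
  have C: "C2_on G f" "C1_on G f" "C1_on G (partial_x f)" "C1_on G (partial_y f)"
    and harmonic: "\<And>z. z \<in> G \<Longrightarrow> partial_x (partial_x f) z + partial_y (partial_y f) z = 0"
    and qr: "\<And>z. z \<in> G \<Longrightarrow> cmod (wirtinger_bar f z) \<le> k * cmod (wirtinger f z)"
    using f by (auto simp: quasiregular_harmonic_on_def harmonic_on_def C2_on_def)
  have q0: "0 < q" using k by (simp add: q)
  have \<gamma>_ball: "\<gamma> s t \<in> ball z0 R" if "s < ln R" for s t
  proof -
    have "exp s < exp (ln R)" using that by (simp only: exp_less_cancel_iff)
    then show ?thesis using R(1) by (simp add: \<gamma>_def E_def dist_norm)
  qed
  have \<gamma>_G: "\<gamma> s t \<in> G" and F0: "F s t \<noteq> 0" if "s < ln R" for s t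
    using \<gamma>_ball[OF that, of t] R nz by (auto simp: F_def)
  have E_s: "((\<lambda>s. E s t) has_vector_derivative E s t) (at s)"
    and E_t: "((\<lambda>t. E s t) has_vector_derivative \<i> * E s t) (at t)" for s t
  proof -
    have "((\<lambda>s. Complex s t) has_vector_derivative 1) (at s)"
      "((\<lambda>t. Complex s t) has_vector_derivative \<i>) (at t)"
      unfolding Complex_eq by (auto intro!: derivative_eq_intros)
    note this[THEN field_vector_diff_chain_at, OF DERIV_exp, unfolded o_def]
    then show "((\<lambda>s. E s t) has_vector_derivative E s t) (at s)"
      "((\<lambda>t. E s t) has_vector_derivative \<i> * E s t) (at t)"
      by (simp_all add: E_def)
  qed
  have \<gamma>_s: "((\<lambda>s. \<gamma> s t) has_vector_derivative E s t) (at s)"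
    and \<gamma>_t: "((\<lambda>t. \<gamma> s t) has_vector_derivative \<i> * E s t) (at t)" for s t
    unfolding \<gamma>_def using E_s[of t s] E_t[of s t] by (auto intro!: derivative_eq_intros)
  have iE_t: "((\<lambda>t. \<i> * E s t) has_vector_derivative - E s t) (at t)" for s t
    using has_vector_derivative_mult_right[OF E_t, of \<i> s t] by simp
  have F_s: "((\<lambda>s. F s t) has_vector_derivative Fs s t) (at s)"
    and F_ss: "((\<lambda>s. Fs s t) has_vector_derivative Fss s t) (at s)"
    and F_t: "((\<lambda>t. F s t) has_vector_derivative Ft s t) (at t)"
    and F_tt: "((\<lambda>t. Ft s t) has_vector_derivative Ftt s t) (at t)" if "s < ln R" for s t
    using C1_on_chain[OF C(2) \<gamma>_G[OF that] \<gamma>_s] C2_on_chain[OF C(1) \<gamma>_G[OF that] \<gamma>_s E_s]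
      C1_on_chain[OF C(2) \<gamma>_G[OF that] \<gamma>_t] C2_on_chain[OF C(1) \<gamma>_G[OF that] \<gamma>_t iE_t]
    by (simp_all add: F_def Fs_def Ft_def Fss_def Ftt_def deriv_along_def[of f "- _"]) (simp add: deriv_along_def)
  let ?D = "{..<ln R} \<times> (UNIV :: real set)"
  have cont_E: "continuous_on ?D (\<lambda>x. E (fst x) (snd x))"
    unfolding E_def Complex_eq by (intro continuous_intros)
  have cont_g: "continuous_on ?D (\<lambda>x. g (\<gamma> (fst x) (snd x)))" if "continuous_on G g" for g :: "complex \<Rightarrow> complex"
    by (rule continuous_on_compose2[OF that])
      (use \<gamma>_G cont_E in \<open>auto simp: \<gamma>_def intro!: continuous_intros\<close>)
  have cont_C1: "continuous_on G g" if "C1_on G g" for g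
    using that differentiable_imp_continuous_within[of g]
    by (intro continuous_at_imp_continuous_on) (auto simp: C1_on_def)
  have cont_dir: "continuous_on ?D (\<lambda>x. deriv_along g (E (fst x) (snd x)) (\<gamma> (fst x) (snd x)))"
    if "C1_on G g" for g
    unfolding deriv_along_def using that cont_E
    by (intro continuous_intros cont_g) (auto simp: C1_on_def)
  have cont_F: "continuous_on ?D (\<lambda>x. F (fst x) (snd x))"
    "continuous_on ?D (\<lambda>x. Fs (fst x) (snd x))" "continuous_on ?D (\<lambda>x. Fss (fst x) (snd x))"
    unfolding F_def Fs_def Fss_def using C
    by (auto intro!: continuous_intros cont_g cont_C1 cont_dir cont_E)
  have "compact (f ` cball z0 R)"
    using continuous_on_subset[OF cont_C1[OF C(2)] R(2)] by (intro compact_continuous_image) auto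
  then obtain B where "\<And>z. z \<in> cball z0 R \<Longrightarrow> cmod (f z) \<le> B"
    by (meson bounded_iff compact_imp_bounded imageI)
  then have F_le: "cmod (F s t) \<le> B" if "s < ln R" for s t
    using \<gamma>_ball[OF that, of t] by (simp add: F_def less_imp_le)
  have laplacian: "0 \<le> V2 Fs Fss s t + V2 Ft Ftt s t" if "s < ln R" for s t
  proof -
    have "Fss s t + Ftt s t = 0"
      using second_derivs_along_rotate[OF harmonic[OF \<gamma>_G[OF that]], of "E s t" t]
      by (simp add: Fss_def Ftt_def algebra_simps)
    then have 1: "F s t \<bullet> Ftt s t = - (F s t \<bullet> Fss s t)"
      by (simp add: add_eq_0_iff)
    have "cmod (Fs s t + \<i> * Ft s t) \<le> k * cmod (Fs s t - \<i> * Ft s t)"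
      using mult_left_mono[OF qr[OF \<gamma>_G[OF that, of t]], of "2 * cmod (E s t)"]
      unfolding Fs_def Ft_def deriv_along_rotate by (simp add: norm_mult mult_ac)
    \<comment> \<open>Once the second derivatives of \<open>F\<close> cancel, the sum of the two
      brackets is the gap in this inequality with \<open>e = F s t\<close>.\<close>
    note quasiconformal_inequality[OF k q this, of "F s t"]
    then have "0 \<le> q * cmod (F s t) powr (q - 4) *
        ((cmod (F s t))\<^sup>2 * (Fs s t \<bullet> Fs s t + Ft s t \<bullet> Ft s t) -
         (2 - q) * ((F s t \<bullet> Fs s t)\<^sup>2 + (F s t \<bullet> Ft s t)\<^sup>2))"
      using q0 by (intro mult_nonneg_nonneg) auto
    then show ?thesis unfolding V2_def 1 by (simp add: algebra_simps)
  qed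
  have "integral {0..2 * pi} (\<lambda>t. cmod (F (ln r1) t) powr q) \<le> integral {0..2 * pi} (\<lambda>t. cmod (F (ln r2) t) powr q)"
  proof (rule log_polar_integral_mono[where V = "\<lambda>s t. cmod (F s t) powr q" and Vs = "V1 Fs"
        and Vss = "V2 Fs Fss" and Vt = "V1 Ft" and Vtt = "V2 Ft Ftt" and S = "ln R" and B = "B powr q"])
    fix s t :: real assume s: "s < ln R"
    show "((\<lambda>s. cmod (F s t) powr q) has_real_derivative V1 Fs s t) (at s)"
      unfolding V1_def by (rule norm_powr_has_real_derivative[OF F_s[OF s] F0[OF s]])
    show "((\<lambda>s. V1 Fs s t) has_real_derivative V2 Fs Fss s t) (at s)"
      unfolding V1_def V2_def by (rule norm_powr_has_second_derivative[OF F_s[OF s] F_ss[OF s] F0[OF s]])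
    show "((\<lambda>t. V1 Ft s t) has_real_derivative V2 Ft Ftt s t) (at t)"
      unfolding V1_def V2_def by (rule norm_powr_has_second_derivative[OF F_t[OF s] F_tt[OF s] F0[OF s]])
    show "cmod (F s t) powr q \<le> B powr q"
      using F_le[OF s] q0 by (intro powr_mono2) auto
  next
    show "V1 Ft s (2 * pi) = V1 Ft s 0" for s
    proof -
      have "E s (2 * pi) = E s 0" by (simp add: E_def exp_eq_polar)
      then show ?thesis by (simp add: V1_def Ft_def F_def \<gamma>_def)
    qed
    show "continuous_on ?D (\<lambda>(s, t). cmod (F s t) powr q)" "continuous_on ?D (\<lambda>(s, t). V1 Fs s t)"
      "continuous_on ?D (\<lambda>(s, t). V2 Fs Fss s t)"
      unfolding split_beta V1_def V2_def using F0
      by (auto intro!: continuous_intros cont_F)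
  qed (use r laplacian in auto)
  moreover have "F (ln r) t = f (z0 + of_real r * exp (\<i> * of_real t))" if "0 < r" for r t
    using that by (simp add: F_def \<gamma>_def E_def Complex_eq exp_add exp_of_real)
  ultimately show ?thesis using r by simp
qed


lemma subharmonic_on_norm_powr:
  assumes k: "0 < k" "k < 1" and q: "q = 4 * k / (k + 1)\<^sup>2"
    and "region G" and f: "quasiregular_harmonic_on k G f"
  shows "subharmonic_on G (\<lambda>z. cmod (f z) powr q)"
proof -
  let ?u = "\<lambda>z. cmod (f z) powr q"
  let ?I = "\<lambda>z0 r. integral {0..2 * pi} (\<lambda>t. ?u (z0 + of_real r * exp (\<i> * of_real t)))"
  have "open G" using assms by (simp add: region_def)
  have "0 < q" using k by (simp add: q)
  have cont_f: "isCont f z" if "z \<in> G" for z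
    using f that differentiable_imp_continuous_within[of f z UNIV]
    by (simp add: quasiregular_harmonic_on_def harmonic_on_def C2_on_def C1_on_def)
  then have cont_u: "continuous_on G ?u"
    using \<open>0 < q\<close> by (intro continuous_on_powr' continuous_intros continuous_at_imp_continuous_on) auto
  have "\<exists>\<epsilon>>0. ball z0 \<epsilon> \<subseteq> G \<and> (\<forall>r. 0 < r \<and> r < \<epsilon> \<longrightarrow> ?u z0 \<le> 1 / (2 * pi) * ?I z0 r)"
    if z0: "z0 \<in> G" for z0
  proof (cases "f z0 = 0")
    case True
    \<comment> \<open>At a zero of \<open>f\<close> the left side is \<open>0 powr q = 0\<close>.
      Since \<open>integral\<close> is 0 for non-integrable functions, no integrability check is
      required.\<close>
    have nonneg: "0 \<le> integral {0..2 * pi} g" if "\<And>t. 0 \<le> g t" for g :: "real \<Rightarrow> real"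
      using that by (cases "g integrable_on {0..2 * pi}") (auto intro: integral_nonneg simp: not_integrable_integral)
    have "0 \<le> ?I z0 r" for r by (rule nonneg) simp
    then show ?thesis using True z0 \<open>open G\<close> by (auto simp: open_contains_ball)
  next
    case False
    obtain R1 where R1: "0 < R1" "cball z0 R1 \<subseteq> G"
      using \<open>open G\<close> z0 open_contains_cball by blast
    obtain R2 where R2: "0 < R2" "\<And>z. dist z0 z < R2 \<Longrightarrow> f z \<noteq> 0"
      using continuous_at_avoid[OF cont_f[OF z0] False] by blast
    define R where "R = min R1 R2"
    have R: "0 < R" "cball z0 R \<subseteq> G" and nz: "\<And>z. z \<in> ball z0 R \<Longrightarrow> f z \<noteq> 0"
      using R1 R2 by (auto simp: R_def)
    have "2 * pi * ?u z0 \<le> ?I z0 r" if r: "0 < r" "r < R" for r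
    \<comment> \<open>The limit at the centre in epsilon form: on a tiny circle of radius
      \<open>\<rho>\<close> continuity costs at most \<open>e / (2 * pi)\<close> pointwise, hence
      \<open>e\<close> after integration, and monotonicity carries the estimate out to
      \<open>r\<close>.\<close>
    proof (rule field_le_epsilon)
      fix e :: real assume "0 < e"
      have "isCont ?u z0" using cont_u \<open>open G\<close> z0 continuous_on_eq_continuous_at by blast
      then obtain d where d: "0 < d" "\<And>z. dist z z0 < d \<Longrightarrow> dist (?u z) (?u z0) < e / (2 * pi)"
        using \<open>0 < e\<close> unfolding continuous_at_eps_delta by (metis divide_pos_pos mult_pos_pos pi_gt_zero zero_less_numeral)
      define \<rho> where "\<rho> = min r (d / 2)"
      have \<rho>: "0 < \<rho>" "\<rho> \<le> r" "\<rho> < d" using d r by (auto simp: \<rho>_def)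
      have circle: "dist (z0 + of_real \<rho> * exp (\<i> * of_real t)) z0 = \<rho>" for t
        using \<rho> by (simp add: dist_norm norm_mult)
      have "integral {0..2 * pi} (\<lambda>_. ?u z0 - e / (2 * pi)) \<le> ?I z0 \<rho>"
      proof (rule integral_le)
        have "z0 + of_real \<rho> * exp (\<i> * of_real t) \<in> G" for t
          using R circle[of t] \<rho> r by (intro subsetD[OF R(2)]) (simp add: dist_commute)
        then show "(\<lambda>t. ?u (z0 + of_real \<rho> * exp (\<i> * of_real t))) integrable_on {0..2 * pi}"
          by (intro integrable_continuous_interval continuous_on_compose2[OF cont_u] continuous_intros) auto
        show "?u z0 - e / (2 * pi) \<le> ?u (z0 + of_real \<rho> * exp (\<i> * of_real t))" for t
          using d(2)[of "z0 + of_real \<rho> * exp (\<i> * of_real t)"] circle[of t] \<rho>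
          by (simp add: dist_real_def abs_less_iff)
      qed auto
      also have "\<dots> \<le> ?I z0 r"
        by (rule integral_circle_norm_powr_mono[OF k q f R nz \<rho>(1,2) r(2)])
      finally show "2 * pi * ?u z0 \<le> ?I z0 r + e" by (simp add: right_diff_distrib)
    qed
    then show ?thesis using R by (intro exI[of _ R]) (auto simp: field_simps)
  qed
  with cont_u show ?thesis by (simp add: subharmonic_on_def)
qed

section \<open>Optimality of the exponent\<close>

text \<open>The Wirtinger derivatives are the constants 1 and \<open>k\<close>, so the
  quasiregularity bound is attained at every point.\<close>

lemma quasiregular_harmonic_on_affine:
  assumes "0 \<le> k"
  shows "quasiregular_harmonic_on k UNIV (\<lambda>z. z + of_real k * cnj z)"
proof -
  let ?f = "\<lambda>z. z + of_real k * cnj z"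
  have "((\<lambda>t. ?f (z + of_real t)) has_vector_derivative 1 + of_real k) (at 0)"
    "((\<lambda>t. ?f (z + \<i> * of_real t)) has_vector_derivative \<i> * (1 - of_real k)) (at 0)" for z
    by (auto intro!: derivative_eq_intros simp: algebra_simps)
  from this[THEN vector_derivative_at]
  have f: "partial_x ?f = (\<lambda>_. 1 + of_real k)" "partial_y ?f = (\<lambda>_. \<i> * (1 - of_real k))"
    by (simp_all add: partial_x_def partial_y_def fun_eq_iff)
  have const: "partial_x (\<lambda>_. c) = (\<lambda>_. 0)" "partial_y (\<lambda>_. c) = (\<lambda>_. 0)" for c
    by (simp_all add: partial_x_def partial_y_def fun_eq_iff)
  have "bounded_linear ?f"
    by (intro bounded_linear_add bounded_linear_ident bounded_linear_const_mult bounded_linear_cnj)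
  then have "?f differentiable (at z)" for z
    using bounded_linear_imp_differentiable by blast
  moreover have "wirtinger ?f z = 1" "wirtinger_bar ?f z = of_real k" for z
    unfolding wirtinger_def wirtinger_bar_def f by (simp_all add: algebra_simps)
  ultimately show ?thesis using assms
    by (simp add: quasiregular_harmonic_on_def harmonic_on_def C2_on_def C1_on_def f const)
qed

lemma powr_half_power2: "x powr p = (x\<^sup>2) powr (p / 2)" if "0 \<le> x" for x :: real
  using that by (simp add: powr_powr flip: powr_numeral)

text \<open>Near \<open>z0 = 1\<close>, with \<open>X + \<i>Y = z - 1\<close>, the function \<open>|f|\<^sup>p\<close> is bounded above by a multiple of
  \<open>1 + pX + d (X\<^sup>2 - Y\<^sup>2) - c (X\<^sup>2 + Y\<^sup>2)\<close> up to third order; the first three terms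
  are harmonic and \<open>c = p (q - p) / 8 > 0\<close>.\<close>

lemma not_subharmonic_on_affine_powr:
  assumes k: "0 < k" "k < 1" and q: "q = 4 * k / (k + 1)\<^sup>2" and p: "0 < p" "p < q"
  shows "\<not> subharmonic_on UNIV (\<lambda>z. cmod (z + of_real k * cnj z) powr p)"
proof
  let ?u = "\<lambda>z. cmod (z + of_real k * cnj z) powr p"
  assume "subharmonic_on UNIV ?u"
  then obtain \<epsilon> where cont: "continuous_on UNIV ?u" and \<epsilon>: "0 < \<epsilon>"
    "\<And>r. 0 < r \<Longrightarrow> r < \<epsilon> \<Longrightarrow>
      ?u 1 \<le> 1 / (2 * pi) * integral {0..2 * pi} (\<lambda>t. ?u (1 + of_real r * exp (\<i> * of_real t)))"
    unfolding subharmonic_on_def by blast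
  define a where "a = p / 2"
  \<comment> \<open>The Taylor coefficient plus a slack. Without slack the isotropic part of the
    quadratic terms would be \<open>- a * (q - p) / 2\<close> times
    \<open>X\<^sup>2 + Y\<^sup>2\<close>; the slack uses up half of it and leaves
    \<open>- c\<close>. The trace-free part has coefficient \<open>d\<close>.\<close>
  define b where "b = a * (a - 1) / 2 + a * (q - p) / 8"
  define c where "c = a * (q - p) / 4"
  define d where "d = (a + 4 * b - a * (1 - q)) / 2"
  define K where "K = ((1 + k)\<^sup>2) powr a"
  have a: "0 < a" and c: "0 < c" and K: "0 < K" using p k by (auto simp: a_def c_def K_def)
  \<comment> \<open>The map stretches by \<open>1 + k\<close> along the real axis and by
    \<open>1 - k\<close> along the imaginary axis, so \<open>1 - q\<close> is the squared ratio of
    the two.\<close>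
  have \<kappa>: "(1 - q) * (1 + k)\<^sup>2 = (1 - k)\<^sup>2"
  proof -
    have "q * (1 + k)\<^sup>2 = 4 * k" using k by (simp add: q add.commute)
    then have "(1 - q) * (1 + k)\<^sup>2 = (1 + k)\<^sup>2 - 4 * k" by (simp only: left_diff_distrib mult_1)
    then show ?thesis by (simp add: power2_eq_square algebra_simps)
  qed
  have "0 \<le> (1 - q) * (1 + k)\<^sup>2" unfolding \<kappa> by simp
  then have q01: "0 \<le> 1 - q" "1 - q \<le> 1"
    using k p by (simp_all add: zero_le_mult_iff)
  obtain \<delta> where \<delta>: "0 < \<delta>" "\<And>x. \<bar>x\<bar> < \<delta> \<Longrightarrow> (1 + x) powr a \<le> 1 + a * x + b * x\<^sup>2"
    using powr_le_quadratic[of "a * (q - p) / 8" a] a p unfolding b_def by auto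
  \<comment> \<open>For \<open>0 < r \<le> e\<close> the cubic error
    \<open>5 * \<bar>b\<bar> * r ^ 3\<close> stays strictly below \<open>c * r\<^sup>2\<close>; the
    summand 1 gives strictness and covers \<open>b = 0\<close>.\<close>
  define e where "e = c / (5 * \<bar>b\<bar> + 1)"
  have e: "0 < e" "e * (5 * \<bar>b\<bar> + 1) = c" using c by (simp_all add: e_def)
  \<comment> \<open>With \<open>r \<le> 1\<close> the increment satisfies
    \<open>\<bar>x\<bar> \<le> 2 * r + r\<^sup>2 \<le> 3 * r\<close>, which is below
    \<open>\<delta>\<close>.\<close>
  define r where "r = min (min 1 (\<epsilon> / 2)) (min (\<delta> / 4) e)"
  have r: "0 < r" "r \<le> 1" "r < \<epsilon>" "3 * r < \<delta>" "r \<le> e"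
    using \<epsilon>(1) \<delta>(1) e(1) by (auto simp: r_def min_def)
  have rc: "5 * \<bar>b\<bar> * r < c"
    using mult_right_mono[OF r(5), of "5 * \<bar>b\<bar> + 1"] e(2) r(1) by (simp add: algebra_simps)
  define m where "m = (5 * \<bar>b\<bar> * r - c) * r\<^sup>2"
  have m: "m < 0" using r(1) rc by (simp add: m_def mult_neg_pos)
  have u: "?u (1 + Complex X Y) \<le> K * (1 + 2 * a * X + d * (X\<^sup>2 - Y\<^sup>2) + m)"
    if XY: "X\<^sup>2 + Y\<^sup>2 = r\<^sup>2" for X Y
  proof -
    define y where "y = X\<^sup>2 + (1 - q) * Y\<^sup>2"
    define x where "x = 2 * X + y"
    have y: "0 \<le> y" "y \<le> r\<^sup>2"
      unfolding y_def XY[symmetric] using q01(1) mult_right_mono[OF q01(2), of "Y\<^sup>2"] by simp_all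
    have X: "\<bar>X\<bar> \<le> r" by (rule power2_le_imp_le) (use r(1) in \<open>simp_all flip: XY\<close>)
    have r2: "r\<^sup>2 \<le> r" using r by (simp add: power2_eq_square)
    have "cmod (1 + Complex X Y + of_real k * cnj (1 + Complex X Y)) ^ 2 = (1 + k)\<^sup>2 * (1 + x)"
      unfolding x_def y_def cmod_power2 using \<kappa>
      by (simp add: complex_eq_iff distrib_left mult.assoc[symmetric] mult.commute[of _ "1 - q"])
        (simp add: power2_eq_square algebra_simps)
    then have u_eq: "?u (1 + Complex X Y) = K * (1 + x) powr a"
      unfolding powr_half_power2[OF norm_ge_zero] K_def a_def
      by (simp add: powr_mult)
    have "(1 + x) powr a \<le> 1 + a * x + b * x\<^sup>2"
      using X y r r2 by (intro \<delta>(2)) (auto simp: x_def)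
    also have "\<dots> = 1 + 2 * a * X + (a * y + 4 * b * X\<^sup>2) + b * (4 * X * y + y\<^sup>2)"
      by (simp add: x_def power2_eq_square algebra_simps)
    also have "a * y + 4 * b * X\<^sup>2 = d * (X\<^sup>2 - Y\<^sup>2) - c * r\<^sup>2"
      unfolding y_def d_def c_def b_def XY[symmetric] by (simp add: a_def field_simps power2_eq_square)
    also have "b * (4 * X * y + y\<^sup>2) \<le> \<bar>b\<bar> * (5 * r * r\<^sup>2)"
    proof -
      have "\<bar>4 * X * y + y\<^sup>2\<bar> \<le> 4 * (\<bar>X\<bar> * y) + y * y"
        using y abs_triangle_ineq[of "4 * X * y" "y\<^sup>2"] by (simp add: abs_mult power2_eq_square)
      also have "\<dots> \<le> 4 * (r * r\<^sup>2) + r * r\<^sup>2"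
        using X y r r2 by (intro add_mono mult_left_mono mult_mono) auto
      finally have "\<bar>b\<bar> * \<bar>4 * X * y + y\<^sup>2\<bar> \<le> \<bar>b\<bar> * (5 * r * r\<^sup>2)"
        by (intro mult_left_mono) auto
      then show ?thesis using abs_ge_self[of "b * (4 * X * y + y\<^sup>2)"] by (simp add: abs_mult)
    qed
    finally have "(1 + x) powr a \<le> 1 + 2 * a * X + d * (X\<^sup>2 - Y\<^sup>2) + m"
      by (simp add: m_def algebra_simps)
    with K show ?thesis unfolding u_eq by (intro mult_left_mono) auto
  qed
  \<comment> \<open>The harmonic terms have the periodic antiderivatives \<open>sin t\<close> and
    \<open>sin t * cos t\<close> up to constants, so only \<open>1 + m\<close> contributes over a
    full turn.\<close>
  have "((\<lambda>t. K * (1 + 2 * a * (r * cos t) + d * ((r * cos t)\<^sup>2 - (r * sin t)\<^sup>2) + m)) has_integral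
      K * ((1 + m) * (2 * pi) + 2 * a * r * sin (2 * pi) + d * r\<^sup>2 * (sin (2 * pi) * cos (2 * pi))) -
      K * ((1 + m) * 0 + 2 * a * r * sin 0 + d * r\<^sup>2 * (sin 0 * cos 0))) {0..2 * pi}"
    by (rule fundamental_theorem_of_calculus)
      (auto intro!: derivative_eq_intros simp: has_real_derivative_iff_has_vector_derivative[symmetric]
        power2_eq_square algebra_simps)
  then have I: "((\<lambda>t. K * (1 + 2 * a * (r * cos t) + d * ((r * cos t)\<^sup>2 - (r * sin t)\<^sup>2) + m)) has_integral
      K * (1 + m) * (2 * pi)) {0..2 * pi}" by (simp add: mult.assoc)
  have le: "integral {0..2 * pi} (\<lambda>t. ?u (1 + of_real r * exp (\<i> * of_real t))) \<le> K * (1 + m) * (2 * pi)"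
  proof (rule integral_le[OF _ has_integral_integrable[OF I], unfolded integral_unique[OF I]])
    show "(\<lambda>t. ?u (1 + of_real r * exp (\<i> * of_real t))) integrable_on {0..2 * pi}"
      by (intro integrable_continuous_interval continuous_on_compose2[OF cont] continuous_intros) auto
    fix t :: real
    have "of_real r * exp (\<i> * of_real t) = Complex (r * cos t) (r * sin t)"
      by (simp add: exp_eq_polar complex_eq_iff Re_exp Im_exp)
    moreover have "(r * cos t)\<^sup>2 + (r * sin t)\<^sup>2 = r\<^sup>2"
      by (simp add: power_mult_distrib flip: distrib_left)
    ultimately show "?u (1 + of_real r * exp (\<i> * of_real t)) \<le>
        K * (1 + 2 * a * (r * cos t) + d * ((r * cos t)\<^sup>2 - (r * sin t)\<^sup>2) + m)"
      using u[of "r * cos t" "r * sin t"] by simp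
  qed
  have "?u 1 \<le> 1 / (2 * pi) * (K * (1 + m) * (2 * pi))"
    by (rule order_trans[OF \<epsilon>(2)[OF r(1,3)] mult_left_mono[OF le]]) simp
  then have "?u 1 \<le> K * (1 + m)" by simp
  moreover have "?u 1 = K"
  proof -
    have "1 + of_real k * cnj 1 = complex_of_real (1 + k)" by simp
    then have "cmod (1 + of_real k * cnj 1) = 1 + k" using k by (simp only: norm_of_real)
    then show ?thesis
      unfolding powr_half_power2[OF norm_ge_zero] K_def a_def by (simp only:)
  qed
  ultimately show False using mult_pos_neg[OF K m] by (simp add: algebra_simps)
qed

theorem theorem1p1:
  fixes k q :: real
  assumes "0 < k" and "k < 1" and "q = 4 * k / (k + 1)^2"
  shows "(\<forall>G f. region G \<and> quasiregular_harmonic_on k G f \<longrightarrow>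
            subharmonic_on G (\<lambda>z. cmod (f z) powr q)) \<and>
         (\<forall>p. 0 < p \<and> p < q \<longrightarrow>
            (\<exists>G f. region G \<and> quasiregular_harmonic_on k G f \<and>
               \<not> subharmonic_on G (\<lambda>z. cmod (f z) powr p)))"
proof (intro conjI allI impI)
  fix G f assume "region G \<and> quasiregular_harmonic_on k G f"
  then show "subharmonic_on G (\<lambda>z. cmod (f z) powr q)"
    using subharmonic_on_norm_powr[OF assms] by blast
next
  fix p assume "0 < p \<and> p < q"
  then have "\<not> subharmonic_on UNIV (\<lambda>z. cmod (z + of_real k * cnj z) powr p)"
    using not_subharmonic_on_affine_powr[OF assms] by blast
  moreover have "region UNIV" by (simp add: region_def convex_connected)
  ultimately show "\<exists>G f. region G \<and> quasiregular_harmonic_on k G f \<and>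
      \<not> subharmonic_on G (\<lambda>z. cmod (f z) powr p)"
    using quasiregular_harmonic_on_affine[of k] assms(1) by (meson less_imp_le)
qed

end
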